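(* Let $(X,d)$ be a proper, doubling metric space and let $(Y,d_Y)$ be an arbitrary metric space. Let $p>1$ and $\alpha\in(0,1)$. If $f:X\rightarrow Y$ is $(p,\alpha)$-compactly Hölder and $E\subset X$ is a bounded set with $\dim_B E=d_E$, then $$\dim_B f(E)\leq \frac{p\,d_E}{\alpha p+d_E}.$$
   Context: Balls are open: $B(x,r)=\{z\in X: d(x,z)<r\}$, $r>0$. A metric space $(X,d)$ is doubling if there is a constant $C_d\geq 1$ such that for every $x\in X$ and $r>0$ the smallest number of balls of radius $r$ needed to cover $B(x,2r)$ is at most $C_d$. A metric space is proper if its closed bounded subsets are compact. Minkowski dimension: for a bounded subset $E$ of a metric space and $r>0$, let $N(E,r)$ be the smallest number of sets of diameter at most $r$ needed to cover $E$. The (upper) Minkowski dimension of $E$ is $$\dim_B E=\limsup_{r\to 0}\frac{\log N(E,r)}{\log(1/r)}.$$ Hölder coefficient: for $\alpha\in(0,1)$, $f:X\to Y$ and $B\subset X$, $$|f|_{\alpha,B}:=\sup\left\{\frac{d_Y(f(x),f(y))}{d(x,y)^\alpha}: x,y\in B \text{ distinct}\right\}.$$ Compactly Hölder mappings: for $p>1$, $\alpha\in(0,1)$, a mapping $f:X\to Y$ between metric spaces is $(p,\alpha)$-compactly Hölder if for any compact set $E\subset X$ and any $\epsilon\in(0,1)$ there are $r_E>0$ and $C_E>0$ satisfying the following: if $\{B_i\}_{i\in I}$ is an (at most countable) collection of balls $B_i=B(x_i,r)$ with $x_i\in X$ and common radius $r<r_E$ that covers $E$ and such that $B(x_i,\epsilon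 r)\cap B(x_j,\epsilon r)=\emptyset$ for all distinct $i,j\in I$, then $$\sum_{i\in I}|f|_{\alpha,B_i}^p\leq C_E.$$ Here, by convention, saying that $\{B(x_i,r)\}_{i\in I}$ covers $E$ also entails that $B(x_i,r)\cap E\neq\emptyset$ for all $i\in I$, but the centers $x_i$ need not lie in $E$. *)

theory Defs
  imports "HOL-Analysis.Analysis"
begin

definition proper_space :: "'a::metric_space itself \<Rightarrow> bool" where
  "proper_space _ \<longleftrightarrow> (\<forall>S::'a set. closed S \<and> bounded S \<longrightarrow> compact S)"

(* Equal to \<infinity> if no finite subfamily of F covers E. *)
definition covering_number :: "'a set set \<Rightarrow> 'a set \<Rightarrow> enat" where
  "covering_number F E = (INF C \<in> {C. finite C \<and> C \<subseteq> F \<and> E \<subseteq> \<Union>C}. enat (card C))"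

definition doubling_space :: "'a::metric_space itself \<Rightarrow> bool" where
  "doubling_space _ \<longleftrightarrow> (\<exists>C\<^sub>d::real. C\<^sub>d \<ge> 1 \<and> (\<forall>(x::'a) r. r > 0 \<longrightarrow>
     ereal_of_enat (covering_number (range (\<lambda>z. ball z r)) (ball x (2 * r))) \<le> ereal C\<^sub>d))"

(* The conjunct bounded A is needed: diameter is real-valued, hence meaningless on unbounded sets. *)
definition diam_covering_number :: "'a::metric_space set \<Rightarrow> real \<Rightarrow> enat" where
  "diam_covering_number E r = covering_number {A. bounded A \<and> diameter A \<le> r} E"

(* Logarithm with values in the extended reals, log 0 = -\<infinity> and log \<infinity> = \<infinity>. *)
definition log_enat :: "enat \<Rightarrow> ereal" where
  "log_enat n = (case n of enat k \<Rightarrow> if k = 0 then -\<infinity> else ereal (ln (real k)) | \<infinity> \<Rightarrow> \<infinity>)"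

(* For every nonempty E this lies in [0, \<infinity>], and in [0, \<infinity>) if E is moreover a bounded subset of a
   doubling space; the empty set gets -\<infinity>. Note that (-\<infinity>) / (-\<infinity>) = 0 in ereal. *)
definition minkowski_dim :: "'a::metric_space set \<Rightarrow> ereal" where
  "minkowski_dim E =
     Limsup (at_right 0) (\<lambda>r::real. log_enat (diam_covering_number E r) / ereal (ln (1 / r)))"

(* The supremum of the empty set (B with at most one point) is 0 in ennreal. *)
definition holder_coeff ::
    "real \<Rightarrow> 'a::metric_space set \<Rightarrow> ('a \<Rightarrow> 'b::metric_space) \<Rightarrow> ennreal" where
  "holder_coeff \<alpha> B f =
     Sup {ennreal (dist (f x) (f y) / dist x y powr \<alpha>) | x y. x \<in> B \<and> y \<in> B \<and> x \<noteq> y}"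

definition ennreal_powr :: "ennreal \<Rightarrow> real \<Rightarrow> ennreal" where
  "ennreal_powr x p = (if x = \<infinity> then \<infinity> else ennreal (enn2real x powr p))"

(* An at most countable family is indexed by a set I of naturals; the final conjunct of the
   premises is the convention that every member of a cover of E meets E. *)
definition compactly_holder ::
    "real \<Rightarrow> real \<Rightarrow> ('a::metric_space \<Rightarrow> 'b::metric_space) \<Rightarrow> bool" where
  "compactly_holder p \<alpha> f \<longleftrightarrow>
     (\<forall>E \<epsilon>. compact E \<and> 0 < \<epsilon> \<and> \<epsilon> < 1 \<longrightarrow>
       (\<exists>r\<^sub>E C\<^sub>E :: real. r\<^sub>E > 0 \<and> C\<^sub>E > 0 \<and>
         (\<forall>(I :: nat set) (x :: nat \<Rightarrow> 'a) r.
            0 < r \<and> r < r\<^sub>E \<and>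
            (\<forall>i\<in>I. \<forall>j\<in>I. i \<noteq> j \<longrightarrow> ball (x i) (\<epsilon> * r) \<inter> ball (x j) (\<epsilon> * r) = {}) \<and>
            E \<subseteq> (\<Union>i\<in>I. ball (x i) r) \<and>
            (\<forall>i\<in>I. ball (x i) r \<inter> E \<noteq> {}) \<longrightarrow>
            (\<Sum>\<^sub>\<infinity>i\<in>I. ennreal_powr (holder_coeff \<alpha> (ball (x i) r) f) p) \<le> ennreal C\<^sub>E)))"

end

theory Submission
  imports Defs
begin

text \<open>
  The idea is to cover \<open>f ` E\<close> by images of balls whose radius is adapted to the local behaviour of
  \<open>f\<close>. Fix a target diameter \<open>\<delta>\<close> and a starting radius \<open>r\<close>, and take maximal \<open>r / 2 ^ n\<close>-separated
  subsets of \<open>E\<close> for all \<open>n\<close>, with balls of radius \<open>2 * r / 2 ^ n\<close> about their points. A ball whose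
  image has diameter at most \<open>\<delta>\<close> is kept. Any other ball is replaced by the balls of the next level
  that meet it, and their number is bounded because the space is doubling.

  A ball of radius comparable to \<open>r / 2 ^ n\<close> whose image has diameter above \<open>\<delta>\<close> has a Hoelder
  coefficient of at least a constant times \<open>\<delta> * (r / 2 ^ n) powr (- \<alpha>)\<close>. Since the \<open>p\<close>-th powers of
  these coefficients have bounded sum over each level, there are at most a constant times
  \<open>\<delta> powr (- p) * (r / 2 ^ n) powr (\<alpha> * p)\<close> such balls (\<open>compactly_holder_card_le\<close>). This is a
  geometric sequence in \<open>n\<close>: from some level on there are no such balls, and altogether the
  procedure (\<open>stopping_time_cover\<close>) yields, with \<open>N E r\<close> denoting the least number of sets of
  diameter at most \<open>r\<close> that cover \<open>E\<close>,

  \<open>N (f ` E) \<delta> \<le> N E (r / 2) + A * \<delta> powr (- p) * r powr (\<alpha> * p)\<close>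

  for a constant \<open>A\<close> (\<open>image_covering_number_le\<close>). If \<open>d\<close> exceeds the dimension of \<open>E\<close>, the first
  term is at most \<open>(r / 2) powr (- d)\<close> for small \<open>r\<close>. The choice \<open>r = \<delta> powr (p / (\<alpha> * p + d))\<close>
  makes both terms comparable to \<open>\<delta> powr (- p * d / (\<alpha> * p + d))\<close>. Hence the dimension of \<open>f ` E\<close>
  is at most \<open>p * d / (\<alpha> * p + d)\<close>, and \<open>d\<close> may tend to the dimension of \<open>E\<close>, which is finite
  in a doubling space.
\<close>

section \<open>Covering numbers and separated sets\<close>

lemma bounded_diameter_le:
  assumes "\<And>x y. x \<in> S \<Longrightarrow> y \<in> S \<Longrightarrow> dist x y \<le> d" "0 \<le> d"
  shows "bounded S \<and> diameter S \<le> d"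
proof
  show "bounded S" unfolding bounded_two_points using assms(1) by blast
  show "diameter S \<le> d" unfolding diameter_def using assms by (auto intro!: cSUP_least)
qed

lemma covering_number_le_enat_iff:
  "covering_number F E \<le> enat k \<longleftrightarrow> (\<exists>C. finite C \<and> C \<subseteq> F \<and> E \<subseteq> \<Union>C \<and> card C \<le> k)"
proof
  assume le: "covering_number F E \<le> enat k"
  show "\<exists>C. finite C \<and> C \<subseteq> F \<and> E \<subseteq> \<Union>C \<and> card C \<le> k"
  proof (rule ccontr)
    assume "\<not> ?thesis"
    then have "enat (Suc k) \<le> covering_number F E"
      unfolding covering_number_def by (intro INF_greatest) force
    with le have "enat (Suc k) \<le> enat k" by (rule order_trans[rotated])
    then show False by simp
  qed
next
  assume "\<exists>C. finite C \<and> C \<subseteq> F \<and> E \<subseteq> \<Union>C \<and> card C \<le> k"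
  then obtain C where "finite C" "C \<subseteq> F" "E \<subseteq> \<Union>C" "card C \<le> k" by blast
  then show "covering_number F E \<le> enat k"
    unfolding covering_number_def by (intro INF_lower2[of C]) auto
qed

lemma covering_number_image_le:
  assumes "covering_number {A. f ` A \<in> F} E \<le> enat k"
  shows "covering_number F (f ` E) \<le> enat k"
proof -
  obtain C where C: "finite C" "C \<subseteq> {A. f ` A \<in> F}" "E \<subseteq> \<Union>C" "card C \<le> k"
    using assms unfolding covering_number_le_enat_iff by blast
  have "finite ((`) f ` C) \<and> (`) f ` C \<subseteq> F \<and> f ` E \<subseteq> \<Union>((`) f ` C) \<and> card ((`) f ` C) \<le> k"
    using C card_image_le[OF C(1), of "(`) f"] by fastforce
  then show ?thesis unfolding covering_number_le_enat_iff by blast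
qed

lemma card_le_if_cover_by_small_sets:
  assumes "pairwise (\<lambda>x y. r \<le> dist x y) T" "T \<subseteq> \<Union>C" "finite C"
    and small: "\<And>A x y. A \<in> C \<Longrightarrow> x \<in> A \<Longrightarrow> y \<in> A \<Longrightarrow> dist x y < r"
  shows "finite T \<and> card T \<le> card C"
proof -
  have "\<forall>x\<in>T. \<exists>A\<in>C. x \<in> A" using assms(2) by blast
  then obtain g where g: "\<And>x. x \<in> T \<Longrightarrow> g x \<in> C \<and> x \<in> g x" by metis
  have "inj_on g T"
  proof (rule inj_onI, rule ccontr)
    fix x y assume xy: "x \<in> T" "y \<in> T" "g x = g y" "x \<noteq> y"
    then have "r \<le> dist x y" using assms(1) by (auto simp: pairwise_def)
    moreover have "dist x y < r" using small[of "g x" x y] g xy by metis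
    ultimately show False by simp
  qed
  moreover have "g ` T \<subseteq> C" using g by blast
  ultimately show ?thesis using assms(3) by (metis card_inj_on_le inj_on_finite)
qed

text \<open>A separated set of maximal cardinality is a net. The maximum exists because no set of
  diameter at most \<open>s < r\<close> contains two points of an \<open>r\<close>-separated set.\<close>

lemma separated_net_exists:
  assumes "diam_covering_number E s \<le> enat m" "s < r" "0 < r"
  obtains X where "X \<subseteq> E" "finite X" "card X \<le> m" "pairwise (\<lambda>x y. r \<le> dist x y) X"
    "\<And>z. z \<in> E \<Longrightarrow> \<exists>x\<in>X. dist x z < r"
proof -
  obtain C where C: "finite C" "C \<subseteq> {A. bounded A \<and> diameter A \<le> s}" "E \<subseteq> \<Union>C" "card C \<le> m"
    using assms(1) unfolding diam_covering_number_def covering_number_le_enat_iff by blast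
  define P where "P X \<longleftrightarrow> X \<subseteq> E \<and> pairwise (\<lambda>x y. r \<le> dist x y) X" for X
  have bound: "finite X \<and> card X \<le> m" if "P X" for X
  proof -
    have "finite X \<and> card X \<le> card C"
    proof (rule card_le_if_cover_by_small_sets[of r])
      fix A x y assume "A \<in> C" "x \<in> A" "y \<in> A"
      then show "dist x y < r"
        using C(2) diameter_bounded_bound[of A x y] assms(2) by fastforce
    qed (use that C P_def in auto)
    with C(4) show ?thesis by linarith
  qed
  have "P {}" by (simp add: P_def)
  moreover have "\<forall>Y. P Y \<longrightarrow> card Y < Suc m" using bound by (simp add: less_Suc_eq_le)
  ultimately obtain X where X: "P X" and max: "\<forall>Y. P Y \<longrightarrow> card Y \<le> card X"
    using ex_has_greatest_nat[of P "{}" card "Suc m"] by blast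
  have "\<exists>x\<in>X. dist x z < r" if "z \<in> E" for z
  proof (rule ccontr)
    assume "\<not> ?thesis"
    then have far: "\<And>x. x \<in> X \<Longrightarrow> r \<le> dist x z" by force
    have "z \<notin> X" using far[of z] assms(3) by auto
    have "P (insert z X)"
      using X far that by (auto simp: P_def pairwise_insert dist_commute)
    with max have "card (insert z X) \<le> card X" by simp
    with \<open>z \<notin> X\<close> show False using bound[OF X] by simp
  qed
  with X bound[OF X] show ?thesis unfolding P_def by (intro that[of X]) auto
qed

section \<open>Doubling spaces\<close>

lemma doubling_iterated_cover:
  assumes "doubling_space TYPE('a::metric_space)"
  shows "\<exists>D::nat. D \<ge> 1 \<and> (\<forall>(x::'a) r k. r > 0 \<longrightarrow>
       (\<exists>Z. finite Z \<and> card Z \<le> D ^ k \<and> ball x (2 ^ k * r) \<subseteq> (\<Union>z\<in>Z. ball z r)))"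
proof -
  obtain Cd :: real where Cd: "Cd \<ge> 1" "\<And>(x::'a) r. r > 0 \<Longrightarrow>
      ereal_of_enat (covering_number (range (\<lambda>z. ball z r)) (ball x (2 * r))) \<le> ereal Cd"
    using assms unfolding doubling_space_def by blast
  define D where "D = nat \<lfloor>Cd\<rfloor>"
  have step: "\<exists>Z. finite Z \<and> card Z \<le> D \<and> ball x (2 * r) \<subseteq> (\<Union>z\<in>Z. ball z r)"
    if r: "r > 0" for x :: 'a and r
  proof -
    let ?n = "covering_number (range (\<lambda>z. ball z r)) (ball x (2 * r))"
    obtain k where k: "?n = enat k" "real k \<le> Cd"
      using Cd(2)[OF r, of x] by (cases ?n) auto
    then have "k \<le> D" unfolding D_def by (simp add: le_nat_floor)
    obtain C where C: "finite C" "C \<subseteq> range (\<lambda>z. ball z r)" "ball x (2 * r) \<subseteq> \<Union>C" "card C \<le> k"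
      using k(1) covering_number_le_enat_iff[of "range (\<lambda>z. ball z r)" "ball x (2 * r)" k] by auto
    obtain Z where Z: "C = (\<lambda>z. ball z r) ` Z" "inj_on (\<lambda>z. ball z r) Z"
      using C(2) by (meson subset_image_inj)
    have "finite Z" "card Z = card C"
      using C(1) Z by (auto simp: card_image finite_image_iff)
    with C Z \<open>k \<le> D\<close> show ?thesis by (intro exI[of _ Z]) auto
  qed
  have iter: "\<exists>Z. finite Z \<and> card Z \<le> D ^ k \<and> ball x (2 ^ k * r) \<subseteq> (\<Union>z\<in>Z. ball z r)"
    if "r > 0" for x :: 'a and r k
  proof (induction k arbitrary: x)
    case 0
    show ?case by (intro exI[of _ "{x}"]) auto
  next
    case (Suc k)
    obtain W where W: "finite W" "card W \<le> D" "ball x (2 * (2 ^ k * r)) \<subseteq> (\<Union>w\<in>W. ball w (2 ^ k * r))"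
      using step[of "2 ^ k * r" x] \<open>r > 0\<close> by auto
    have "\<forall>w::'a. \<exists>Z. finite Z \<and> card Z \<le> D ^ k \<and> ball w (2 ^ k * r) \<subseteq> (\<Union>z\<in>Z. ball z r)"
      by (intro allI Suc.IH)
    from choice[OF this] obtain Z :: "'a \<Rightarrow> 'a set" where
      Z: "\<forall>w. finite (Z w) \<and> card (Z w) \<le> D ^ k \<and> ball w (2 ^ k * r) \<subseteq> (\<Union>z\<in>Z w. ball z r)"
      by (rule exE)
    have "card (\<Union>w\<in>W. Z w) \<le> (\<Sum>w\<in>W. card (Z w))" using W(1) by (rule card_UN_le)
    also have "\<dots> \<le> (\<Sum>w\<in>W. D ^ k)" by (intro sum_mono) (simp add: Z)
    also have "\<dots> \<le> D ^ Suc k" using W(2) by simp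
    finally have "card (\<Union>w\<in>W. Z w) \<le> D ^ Suc k" .
    moreover have "ball x (2 ^ Suc k * r) \<subseteq> (\<Union>z\<in>(\<Union>w\<in>W. Z w). ball z r)"
    proof -
      have "ball x (2 ^ Suc k * r) \<subseteq> (\<Union>w\<in>W. ball w (2 ^ k * r))"
        using W(3) by (simp add: mult.assoc)
      also have "\<dots> \<subseteq> (\<Union>w\<in>W. \<Union>z\<in>Z w. ball z r)" using Z by (intro UN_mono subset_refl) simp
      also have "\<dots> = (\<Union>z\<in>(\<Union>w\<in>W. Z w). ball z r)" by simp
      finally show ?thesis .
    qed
    moreover have "finite (\<Union>w\<in>W. Z w)" using W(1) Z by simp
    ultimately show ?case by (intro exI[of _ "\<Union>w\<in>W. Z w"] conjI)
  qed
  have "D \<ge> 1" using Cd(1) unfolding D_def by linarith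
  with iter show ?thesis by (intro exI[of _ D]) simp
qed

text \<open>In the multiscale construction this bounds the number of balls that replace one ball of the
  preceding scale.\<close>

lemma separated_subset_ball_card_le:
  assumes "doubling_space TYPE('a::metric_space)"
  obtains D :: nat where
    "\<And>(x::'a) r T. r > 0 \<Longrightarrow> pairwise (\<lambda>x y. r / 2 \<le> dist x y) T \<Longrightarrow> T \<subseteq> ball x (4 * r) \<Longrightarrow> card T \<le> D"
proof -
  obtain D :: nat where D: "D \<ge> 1" "\<forall>(x::'a) r k. r > 0 \<longrightarrow>
       (\<exists>Z. finite Z \<and> card Z \<le> D ^ k \<and> ball x (2 ^ k * r) \<subseteq> (\<Union>z\<in>Z. ball z r))"
    using doubling_iterated_cover[OF assms] by (elim exE conjE)
  have "card T \<le> D ^ 4"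
    if T: "r > 0" "pairwise (\<lambda>x y. r / 2 \<le> dist x y) T" "T \<subseteq> ball x (4 * r)" for x :: 'a and r T
  proof -
    obtain Z where Z: "finite Z" "card Z \<le> D ^ 4" "ball x (4 * r) \<subseteq> (\<Union>z\<in>Z. ball z (r / 4))"
      using D(2)[rule_format, of "r / 4" 4 x] T(1) by auto
    have "finite T \<and> card T \<le> card ((\<lambda>z. ball z (r / 4)) ` Z)"
    proof (rule card_le_if_cover_by_small_sets[OF T(2)])
      fix A y y' assume A: "A \<in> (\<lambda>z. ball z (r / 4)) ` Z" "y \<in> A" "y' \<in> A"
      then obtain z where "dist z y < r / 4" "dist z y' < r / 4" by auto
      then show "dist y y' < r / 2"
        using dist_triangle_half_r[of z y "r / 2" y'] by simp
    qed (use Z T in auto)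
    with card_image_le[OF Z(1)] Z(2) show ?thesis by (meson order_trans)
  qed
  from that[OF this] show ?thesis .
qed

text \<open>The exponent is \<open>log 2 D\<close>: halving the radius \<open>log 2 (2 * R / r)\<close> times reduces a ball of
  radius \<open>R\<close> to balls of radius \<open>r / 2\<close>.\<close>

lemma bounded_covering_number_polynomial:
  fixes E :: "'a::metric_space set"
  assumes "doubling_space TYPE('a)" "bounded E"
  obtains C s :: real where "C > 0" "\<And>r. 0 < r \<Longrightarrow> r < 1 \<Longrightarrow>
    \<exists>k. diam_covering_number E r \<le> enat k \<and> real k \<le> C * r powr (- s)"
proof -
  obtain D :: nat where D: "D \<ge> 1" "\<forall>(x::'a) r k. r > 0 \<longrightarrow>
       (\<exists>Z. finite Z \<and> card Z \<le> D ^ k \<and> ball x (2 ^ k * r) \<subseteq> (\<Union>z\<in>Z. ball z r))"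
    using doubling_iterated_cover[OF assms(1)] by (elim exE conjE)
  obtain x R0 where "E \<subseteq> ball x R0" using assms(2) bounded_subset_ballD by metis
  define R where "R = max R0 1"
  have R: "R \<ge> 1" "E \<subseteq> ball x R" using \<open>E \<subseteq> ball x R0\<close> by (auto simp: R_def)
  define s where "s = log 2 (real D)"
  define C where "C = D * (2 * R) powr s"
  have main: "\<exists>k. diam_covering_number E r \<le> enat k \<and> real k \<le> C * r powr (- s)"
    if r: "0 < r" "r < 1" for r :: real
  proof -
    define u where "u = 2 * R / r"
    have "1 * r \<le> 2 * R" using R r by linarith
    then have u: "u \<ge> 1" using r by (simp add: u_def field_simps)
    define k where "k = nat \<lceil>log 2 u\<rceil>"
    have k: "log 2 u \<le> real k" "real k \<le> log 2 u + 1"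
      using u by (auto simp: k_def)
    have "u = 2 powr (log 2 u)" using u by simp
    also have "\<dots> \<le> 2 powr (real k)" using k(1) by (intro powr_mono) auto
    finally have "R \<le> 2 ^ k * (r / 2)" using r by (simp add: u_def powr_realpow field_simps)
    moreover obtain Z where Z: "finite Z" "card Z \<le> D ^ k" "ball x (2 ^ k * (r / 2)) \<subseteq> (\<Union>z\<in>Z. ball z (r / 2))"
      using D(2)[rule_format, of "r / 2" k x] r by auto
    ultimately have "E \<subseteq> (\<Union>z\<in>Z. ball z (r / 2))" using R(2) by fastforce
    moreover have "bounded (ball z (r / 2)) \<and> diameter (ball z (r / 2)) \<le> r" for z :: 'a
    proof (rule bounded_diameter_le)
      fix x y assume "x \<in> ball z (r / 2)" "y \<in> ball z (r / 2)"
      then show "dist x y \<le> r" using dist_triangle_half_r[of z x r y] by simp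
    qed (use r in simp)
    ultimately have "(\<lambda>z. ball z (r / 2)) ` Z \<subseteq> {A. bounded A \<and> diameter A \<le> r} \<and>
        E \<subseteq> \<Union>((\<lambda>z. ball z (r / 2)) ` Z)" by blast
    moreover have "card ((\<lambda>z. ball z (r / 2)) ` Z) \<le> D ^ k"
      using Z card_image_le order_trans by blast
    ultimately have "diam_covering_number E r \<le> enat (D ^ k)"
      unfolding diam_covering_number_def covering_number_le_enat_iff using Z(1)
      by (intro exI[of _ "(\<lambda>z. ball z (r / 2)) ` Z"] conjI finite_imageI) simp_all
    moreover have "real (D ^ k) \<le> C * r powr (- s)"
    proof -
      have "real (D ^ k) = real D powr (real k)" using D(1) by (simp add: powr_realpow)
      also have "\<dots> \<le> real D powr (log 2 u + 1)" using D(1) k(2) by (intro powr_mono) auto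
      also have "\<dots> = D * (real D powr log 2 u)" using D(1) by (simp add: powr_add)
      also have "real D powr log 2 u = u powr s"
        using D(1) u by (simp add: powr_def s_def log_def)
      also have "u powr s = (2 * R) powr s * r powr (- s)"
        using r R by (simp add: u_def powr_divide powr_minus_divide)
      finally show ?thesis by (simp add: C_def)
    qed
    ultimately show ?thesis by blast
  qed
  have "C > 0" using D(1) R by (simp add: C_def)
  from that[OF this main] show ?thesis .
qed

section \<open>Stopping-time covers\<close>

text \<open>Each point is covered by the set containing it at the first level where that set lies in
  the admissible family \<open>F\<close>. Such a set is either at level \<open>0\<close> or meets an inadmissible set of the
  preceding level, so the number of sets used is at most \<open>card (X 0)\<close> plus \<open>D\<close> times the number
  of inadmissible sets. The process stops because \<open>b * q ^ n < 1\<close> for large \<open>n\<close>, which forces all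
  sets of level \<open>n\<close> to be admissible.\<close>

lemma stopping_time_cover:
  fixes U :: "nat \<Rightarrow> 'i \<Rightarrow> 'a set" and b q :: real
  assumes fin: "\<And>n. finite (X n)"
    and cover: "\<And>n. E \<subseteq> (\<Union>x\<in>X n. U n x)"
    and children: "\<And>n y. y \<in> X n \<Longrightarrow> card {x \<in> X (Suc n). U (Suc n) x \<inter> U n y \<noteq> {}} \<le> D"
    and bad: "\<And>n. real (card {x \<in> X n. U n x \<notin> F}) \<le> b * q ^ n"
    and q: "0 \<le> q" "q < 1"
  shows "\<exists>k. covering_number F E \<le> enat k \<and> real k \<le> card (X 0) + D * (b / (1 - q))"
proof -
  define ch where "ch n y = {x \<in> X (Suc n). U (Suc n) x \<inter> U n y \<noteq> {}}" for n y
  define Bad where "Bad n = {x \<in> X n. U n x \<notin> F}" for n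
  have finBad: "finite (Bad n)" and finch: "finite (ch n y)" for n y
    using fin by (auto simp: Bad_def ch_def)
  have "b \<ge> 0" using bad[of 0] by simp
  have "(\<lambda>n. b * q ^ n) \<longlonglongrightarrow> b * 0"
    using q by (intro tendsto_mult tendsto_const LIMSEQ_power_zero) auto
  then have "eventually (\<lambda>n. b * q ^ n < 1) sequentially"
    by (intro order_tendstoD(2)) auto
  then obtain N where "b * q ^ N < 1" by (auto simp: eventually_sequentially)
  with bad[of N] have "real (card (Bad N)) < 1" by (simp add: Bad_def)
  then have "Bad N = {}" using finBad[of N] by simp
  define S where "S = U 0 ` X 0 \<union> (\<Union>n<N. \<Union>y\<in>Bad n. U (Suc n) ` ch n y)"
  have finS: "finite S" unfolding S_def using fin finBad finch by blast
  have "E \<subseteq> \<Union>(S \<inter> F)"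
  proof
    fix z assume "z \<in> E"
    with cover have "\<forall>n. \<exists>x\<in>X n. z \<in> U n x" by blast
    then obtain g where g: "\<And>n. g n \<in> X n" "\<And>n. z \<in> U n (g n)" by metis
    have good_N: "U N (g N) \<in> F" using \<open>Bad N = {}\<close> g(1)[of N] by (auto simp: Bad_def)
    define n where "n = (LEAST n. U n (g n) \<in> F)"
    have good: "U n (g n) \<in> F" unfolding n_def by (rule LeastI[of _ N]) (rule good_N)
    have "n \<le> N" unfolding n_def by (rule Least_le) (rule good_N)
    have "U n (g n) \<in> S"
    proof (cases n)
      case 0
      then show ?thesis using g by (auto simp: S_def)
    next
      case (Suc m)
      then have "U m (g m) \<notin> F" using not_less_Least[of m "\<lambda>n. U n (g n) \<in> F"] n_def by simp
      then have "g m \<in> Bad m" using g by (simp add: Bad_def)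
      moreover have "g (Suc m) \<in> ch m (g m)" using g(1)[of "Suc m"] g(2)[of m] g(2)[of "Suc m"] by (auto simp: ch_def)
      moreover have "m < N" using Suc \<open>n \<le> N\<close> by simp
      ultimately show ?thesis unfolding S_def Suc by blast
    qed
    with good g(2) show "z \<in> \<Union>(S \<inter> F)" by blast
  qed
  then have "covering_number F E \<le> enat (card (S \<inter> F))"
    unfolding covering_number_le_enat_iff using finS by (intro exI[of _ "S \<inter> F"]) auto
  moreover have "real (card (S \<inter> F)) \<le> card (X 0) + D * (b / (1 - q))"
  proof -
    have "card (S \<inter> F) \<le> card S" using finS by (intro card_mono) auto
    also have "card S \<le> card (U 0 ` X 0) + card (\<Union>n<N. \<Union>y\<in>Bad n. U (Suc n) ` ch n y)"
      unfolding S_def by (rule card_Un_le)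
    also have "card (U 0 ` X 0) \<le> card (X 0)" by (rule card_image_le[OF fin])
    also have "card (\<Union>n<N. \<Union>y\<in>Bad n. U (Suc n) ` ch n y) \<le> (\<Sum>n<N. card (\<Union>y\<in>Bad n. U (Suc n) ` ch n y))"
      by (rule card_UN_le) simp
    also have "\<dots> \<le> (\<Sum>n<N. D * card (Bad n))"
    proof (rule sum_mono)
      fix n
      have "card (\<Union>y\<in>Bad n. U (Suc n) ` ch n y) \<le> (\<Sum>y\<in>Bad n. card (U (Suc n) ` ch n y))"
        by (rule card_UN_le[OF finBad])
      also have "\<dots> \<le> (\<Sum>y\<in>Bad n. D)"
      proof (rule sum_mono)
        fix y assume "y \<in> Bad n"
        then have "card (ch n y) \<le> D" using children by (auto simp: Bad_def ch_def)
        then show "card (U (Suc n) ` ch n y) \<le> D"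
          using card_image_le[OF finch[of n y], of "U (Suc n)"] by linarith
      qed
      finally show "card (\<Union>y\<in>Bad n. U (Suc n) ` ch n y) \<le> D * card (Bad n)"
        by (simp add: mult.commute)
    qed
    finally have "card (S \<inter> F) \<le> card (X 0) + (\<Sum>n<N. D * card (Bad n))" by simp
    then have "real (card (S \<inter> F)) \<le> real (card (X 0)) + D * (\<Sum>n<N. real (card (Bad n)))"
      by (simp add: sum_distrib_left flip: of_nat_sum of_nat_mult of_nat_add)
    also have "(\<Sum>n<N. real (card (Bad n))) \<le> (\<Sum>n<N. b * q ^ n)"
      by (intro sum_mono) (use bad in \<open>simp add: Bad_def\<close>)
    also have "\<dots> = b * (\<Sum>n<N. q ^ n)" by (simp add: sum_distrib_left)
    also have "(\<Sum>n<N. q ^ n) \<le> (\<Sum>n. q ^ n)"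
      using q by (intro sum_le_suminf summable_geometric) auto
    also have "(\<Sum>n. q ^ n) = 1 / (1 - q)" using q by (intro suminf_geometric) auto
    finally show ?thesis using \<open>b \<ge> 0\<close> by (simp add: mult_left_mono)
  qed
  ultimately show ?thesis by blast
qed

section \<open>Balls with a large Hoelder coefficient\<close>

lemma diameter_image_ball_le:
  assumes "holder_coeff \<alpha> (ball x R) f \<le> ennreal t" "t \<ge> 0" "\<alpha> > 0"
  shows "bounded (f ` ball x R) \<and> diameter (f ` ball x R) \<le> t * (2 * R) powr \<alpha>"
proof -
  have le: "dist (f y) (f z) \<le> t * (2 * R) powr \<alpha>" if yz: "y \<in> ball x R" "z \<in> ball x R" for y z
  proof (cases "y = z")
    case False
    have "dist y z < 2 * R" using yz dist_triangle_half_r[of x y "2 * R" z] by simp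
    have "ennreal (dist (f y) (f z) / dist y z powr \<alpha>) \<le> holder_coeff \<alpha> (ball x R) f"
      unfolding holder_coeff_def by (intro Sup_upper) (use yz False in blast)
    with assms(1) have "ennreal (dist (f y) (f z) / dist y z powr \<alpha>) \<le> ennreal t" by simp
    then have "dist (f y) (f z) / dist y z powr \<alpha> \<le> t" using assms(2) by simp
    then have "dist (f y) (f z) \<le> t * dist y z powr \<alpha>" using False by (simp add: field_simps)
    also have "\<dots> \<le> t * (2 * R) powr \<alpha>"
      using assms \<open>dist y z < 2 * R\<close> by (intro mult_left_mono powr_mono2) auto
    finally show ?thesis .
  qed (use assms in simp)
  show ?thesis by (rule bounded_diameter_le) (use le assms(2) in auto)
qed

text \<open>Chebyshev's inequality for the sum that the compactly Hoelder condition controls. Balls of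
  radius \<open>2 * r\<close> about an \<open>r\<close>-separated set are used with \<open>\<epsilon> = 1 / 4\<close>: shrinking them by this
  factor gives radius \<open>r / 2\<close>, which makes them disjoint.\<close>

lemma compactly_holder_card_le:
  fixes f :: "'a::metric_space \<Rightarrow> 'b::metric_space"
  assumes "compactly_holder p \<alpha> f" "compact K" "p > 0"
  obtains \<rho> C :: real where "\<rho> > 0" "C > 0"
    "\<And>X r t. finite X \<Longrightarrow> X \<subseteq> K \<Longrightarrow> 0 < r \<Longrightarrow> r < \<rho> \<Longrightarrow> pairwise (\<lambda>x y. r \<le> dist x y) X \<Longrightarrow>
       K \<subseteq> (\<Union>x\<in>X. ball x (2 * r)) \<Longrightarrow> 0 < t \<Longrightarrow>
       real (card {x \<in> X. ennreal t < holder_coeff \<alpha> (ball x (2 * r)) f}) \<le> C * t powr (- p)"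
proof -
  obtain r\<^sub>K C\<^sub>K :: real where pos: "r\<^sub>K > 0" "C\<^sub>K > 0" and bound: "\<And>(I :: nat set) x r.
      0 < r \<Longrightarrow> r < r\<^sub>K \<Longrightarrow>
      (\<forall>i\<in>I. \<forall>j\<in>I. i \<noteq> j \<longrightarrow> ball (x i) (1 / 4 * r) \<inter> ball (x j) (1 / 4 * r) = {}) \<Longrightarrow>
      K \<subseteq> (\<Union>i\<in>I. ball (x i) r) \<Longrightarrow> (\<forall>i\<in>I. ball (x i) r \<inter> K \<noteq> {}) \<Longrightarrow>
      (\<Sum>\<^sub>\<infinity>i\<in>I. ennreal_powr (holder_coeff \<alpha> (ball (x i) r) f) p) \<le> ennreal C\<^sub>K"
    using assms(1,2) unfolding compactly_holder_def
    by (elim allE[of _ K] allE[of _ "1 / 4 :: real"]) auto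
  have main: "real (card {x \<in> X. ennreal t < holder_coeff \<alpha> (ball x (2 * r)) f}) \<le> C\<^sub>K * t powr (- p)"
    if X: "finite X" "X \<subseteq> K" "0 < r" "r < r\<^sub>K / 2" "pairwise (\<lambda>x y. r \<le> dist x y) X"
       "K \<subseteq> (\<Union>x\<in>X. ball x (2 * r))" "0 < t" for X r t
  proof -
    define h where "h x = ennreal_powr (holder_coeff \<alpha> (ball x (2 * r)) f) p" for x
    define Y where "Y = {x \<in> X. ennreal t < holder_coeff \<alpha> (ball x (2 * r)) f}"
    obtain e where e: "bij_betw e {0..<card X} X"
      using ex_bij_betw_nat_finite[OF X(1)] by blast
    let ?I = "{0..<card X}"
    have img: "e ` ?I = X" and inj: "inj_on e ?I" using e by (auto simp: bij_betw_def)
    have "(\<Sum>\<^sub>\<infinity>i\<in>?I. ennreal_powr (holder_coeff \<alpha> (ball (e i) (2 * r)) f) p) \<le> ennreal C\<^sub>K"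
    proof (rule bound)
      show "\<forall>i\<in>?I. \<forall>j\<in>?I. i \<noteq> j \<longrightarrow> ball (e i) (1 / 4 * (2 * r)) \<inter> ball (e j) (1 / 4 * (2 * r)) = {}"
      proof (intro ballI impI)
        fix i j assume ij: "i \<in> ?I" "j \<in> ?I" "i \<noteq> j"
        then have "e i \<noteq> e j" "e i \<in> X" "e j \<in> X" using inj img by (auto dest: inj_onD)
        then have "r \<le> dist (e i) (e j)" using X(5) by (auto simp: pairwise_def)
        then show "ball (e i) (1 / 4 * (2 * r)) \<inter> ball (e j) (1 / 4 * (2 * r)) = {}"
          using dist_triangle_half_l[of "e i" _ r "e j"] by fastforce
      qed
      show "K \<subseteq> (\<Union>i\<in>?I. ball (e i) (2 * r))"
      proof -
        have "K \<subseteq> (\<Union>x\<in>e ` ?I. ball x (2 * r))" unfolding img by (rule X(6))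
        then show ?thesis by simp
      qed
      show "\<forall>i\<in>?I. ball (e i) (2 * r) \<inter> K \<noteq> {}"
      proof
        fix i assume "i \<in> ?I"
        then have "e i \<in> K" using img X(2) by blast
        moreover have "e i \<in> ball (e i) (2 * r)" using X(3) by simp
        ultimately show "ball (e i) (2 * r) \<inter> K \<noteq> {}" by blast
      qed
    qed (use X in auto)
    also have "(\<Sum>\<^sub>\<infinity>i\<in>?I. ennreal_powr (holder_coeff \<alpha> (ball (e i) (2 * r)) f) p) = (\<Sum>x\<in>X. h x)"
      using sum.reindex_bij_betw[OF e, of h] by (simp add: h_def)
    finally have sum: "(\<Sum>x\<in>X. h x) \<le> ennreal C\<^sub>K" .
    have h_ge: "ennreal (t powr p) \<le> h x" if "x \<in> Y" for x
    proof (cases "holder_coeff \<alpha> (ball x (2 * r)) f")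
      case (real c)
      with that \<open>0 < t\<close> have "t < c" by (simp add: Y_def ennreal_less_iff)
      with real \<open>0 < t\<close> \<open>p > 0\<close> show ?thesis
        by (auto simp: h_def ennreal_powr_def intro!: ennreal_leI powr_mono2)
    qed (simp add: h_def ennreal_powr_def)
    have "ennreal (card Y * t powr p) = (\<Sum>x\<in>Y. ennreal (t powr p))"
      by (simp add: ennreal_mult ennreal_of_nat_eq_real_of_nat)
    also have "\<dots> \<le> (\<Sum>x\<in>Y. h x)" by (intro sum_mono h_ge)
    also have "\<dots> \<le> (\<Sum>x\<in>X. h x)" using X(1) by (intro sum_mono2) (auto simp: Y_def)
    also note sum
    finally have "card Y * t powr p \<le> C\<^sub>K" using pos by (simp add: ennreal_le_iff)
    then show ?thesis using \<open>0 < t\<close> by (simp add: Y_def powr_minus field_simps)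
  qed
  show ?thesis using that[of "r\<^sub>K / 2" C\<^sub>K] pos main by simp
qed

section \<open>Covering the image\<close>

text \<open>The stopping-time cover is applied to nets of \<open>E\<close> at the scales \<open>r / 2 ^ n\<close>, a ball being
  admissible when its image has diameter at most \<open>\<delta>\<close>. An inadmissible ball of level \<open>n\<close> has Hoelder
  coefficient above \<open>\<delta> / (4 * (r / 2 ^ n)) powr \<alpha>\<close>, so the number of them decays like
  \<open>2 powr (- \<alpha> * p * n)\<close>.\<close>

lemma image_covering_number_le:
  fixes f :: "'a::metric_space \<Rightarrow> 'b::metric_space"
  assumes "doubling_space TYPE('a)" "compactly_holder p \<alpha> f" "bounded E" "compact (closure E)"
    "p > 0" "\<alpha> > 0"
  obtains \<rho> A :: real where "\<rho> > 0" "A > 0"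
    "\<And>\<delta> r m. \<delta> > 0 \<Longrightarrow> 0 < r \<Longrightarrow> r < \<rho> \<Longrightarrow> diam_covering_number E (r / 2) \<le> enat m \<Longrightarrow>
       \<exists>k. diam_covering_number (f ` E) \<delta> \<le> enat k \<and> real k \<le> m + A * \<delta> powr (- p) * r powr (\<alpha> * p)"
proof -
  obtain D :: nat where D: "\<And>(x::'a) r T. r > 0 \<Longrightarrow> pairwise (\<lambda>x y. r / 2 \<le> dist x y) T \<Longrightarrow>
      T \<subseteq> ball x (4 * r) \<Longrightarrow> card T \<le> D"
    by (rule separated_subset_ball_card_le[OF assms(1)]) blast
  obtain \<rho>0 C :: real where \<rho>0: "\<rho>0 > 0" and "C > 0" and count:
    "\<And>X r t. finite X \<Longrightarrow> X \<subseteq> closure E \<Longrightarrow> 0 < r \<Longrightarrow> r < \<rho>0 \<Longrightarrow> pairwise (\<lambda>x y. r \<le> dist x y) X \<Longrightarrow>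
       closure E \<subseteq> (\<Union>x\<in>X. ball x (2 * r)) \<Longrightarrow> 0 < t \<Longrightarrow>
       real (card {x \<in> X. ennreal t < holder_coeff \<alpha> (ball x (2 * r)) f}) \<le> C * t powr (- p)"
    by (rule compactly_holder_card_le[OF assms(2,4,5)]) blast
  obtain c s :: real where fin_cover: "\<And>r. 0 < r \<Longrightarrow> r < 1 \<Longrightarrow>
      \<exists>k. diam_covering_number E r \<le> enat k \<and> real k \<le> c * r powr (- s)"
    by (rule bounded_covering_number_polynomial[OF assms(1,3)]) blast
  define q where "q = 2 powr (- \<alpha> * p)"
  have q: "0 \<le> q" "q < 1"
    using assms(5,6) by (auto simp: q_def powr_less_one)
  \<comment> \<open>The summand \<open>1\<close> keeps \<open>A\<close> positive in case \<open>D = 0\<close>.\<close>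
  define A where "A = D * (C * 4 powr (\<alpha> * p) / (1 - q)) + 1"
  have "A > 0" using \<open>C > 0\<close> q by (auto simp: A_def intro!: add_nonneg_pos mult_nonneg_nonneg divide_nonneg_nonneg)
  have main: "\<exists>k. diam_covering_number (f ` E) \<delta> \<le> enat k \<and> real k \<le> m + A * \<delta> powr (- p) * r powr (\<alpha> * p)"
    if \<delta>: "\<delta> > 0" and r: "0 < r" "r < min \<rho>0 1" and m: "diam_covering_number E (r / 2) \<le> enat m"
    for \<delta> r :: real and m
  proof -
    define l where "l n = r / 2 ^ n" for n :: nat
    have l: "0 < l n" "l n \<le> r" "l (Suc n) = l n / 2" for n
      using r by (auto simp: l_def field_simps)
    \<comment> \<open>Only the size of the coarsest net enters the final count; from the finer ones only
      finiteness is required.\<close>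
    define net where "net n X \<longleftrightarrow> X \<subseteq> E \<and> finite X \<and> pairwise (\<lambda>x y. l n \<le> dist x y) X \<and>
      (\<forall>z\<in>E. \<exists>x\<in>X. dist x z < l n) \<and> (n = 0 \<longrightarrow> card X \<le> m)" for n X
    have "\<exists>X. net n X" for n
    proof -
      have "\<exists>k. diam_covering_number E (l n / 2) \<le> enat k \<and> (n = 0 \<longrightarrow> k = m)"
      proof (cases "n = 0")
        case True
        then show ?thesis using m by (auto simp: l_def)
      next
        case False
        then show ?thesis using fin_cover[of "l n / 2"] l[of n] r by force
      qed
      then obtain k where k: "diam_covering_number E (l n / 2) \<le> enat k" "n = 0 \<longrightarrow> k = m" by blast
      have "l n / 2 < l n" using l by simp
      from separated_net_exists[OF k(1) this l(1)] show ?thesis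
        unfolding net_def using k(2) by metis
    qed
    then obtain X where X: "\<And>n. net n (X n)" by metis
    define U where "U n x = ball x (2 * l n)" for n and x :: 'a
    define F where "F = {B. f ` B \<in> {A. bounded A \<and> diameter A \<le> \<delta>}}"
    define b where "b = C * \<delta> powr (- p) * (4 * r) powr (\<alpha> * p)"
    have "\<exists>k. covering_number F E \<le> enat k \<and> real k \<le> card (X 0) + D * (b / (1 - q))"
    proof (rule stopping_time_cover[where U = U])
      fix n
      show "finite (X n)" using X by (simp add: net_def)
      show "E \<subseteq> (\<Union>x\<in>X n. U n x)"
      proof
        fix z assume "z \<in> E"
        then obtain x where "x \<in> X n" "dist x z < l n" using X[of n] by (auto simp: net_def)
        then show "z \<in> (\<Union>x\<in>X n. U n x)" using l(1)[of n] by (force simp: U_def)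
      qed
      show "card {x \<in> X (Suc n). U (Suc n) x \<inter> U n y \<noteq> {}} \<le> D" for y
      proof (rule D[OF l(1)[of n]])
        show "pairwise (\<lambda>x y. l n / 2 \<le> dist x y) {x \<in> X (Suc n). U (Suc n) x \<inter> U n y \<noteq> {}}"
          using X[of "Suc n"] by (auto simp: net_def l(3) pairwise_def)
        show "{x \<in> X (Suc n). U (Suc n) x \<inter> U n y \<noteq> {}} \<subseteq> ball y (4 * l n)"
        proof
          fix x assume "x \<in> {x \<in> X (Suc n). U (Suc n) x \<inter> U n y \<noteq> {}}"
          then obtain z where "dist x z < l n" "dist y z < 2 * l n" by (auto simp: U_def l(3))
          then show "x \<in> ball y (4 * l n)"
            using dist_triangle2[of y x z] l(1)[of n] by simp
        qed
      qed
      show "real (card {x \<in> X n. U n x \<notin> F}) \<le> b * q ^ n"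
      proof -
        define t where "t = \<delta> / (4 * l n) powr \<alpha>"
        have "t > 0" using \<delta> l(1)[of n] by (simp add: t_def)
        have good: "U n x \<in> F" if "holder_coeff \<alpha> (U n x) f \<le> ennreal t" for x
        proof -
          have "t * (2 * (2 * l n)) powr \<alpha> = \<delta>" using l(1)[of n] by (simp add: t_def)
          then show ?thesis
            using diameter_image_ball_le[of \<alpha> x "2 * l n" f t] that \<open>t > 0\<close> \<open>\<alpha> > 0\<close>
            by (simp add: U_def F_def)
        qed
        have cover_closure: "closure E \<subseteq> (\<Union>x\<in>X n. ball x (2 * l n))"
        proof
          fix z assume "z \<in> closure E"
          then obtain y where "y \<in> E" "dist y z < l n"
            using l(1)[of n] by (auto simp: closure_approachable)
          moreover from this obtain x where "x \<in> X n" "dist x y < l n"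
            using X[of n] by (auto simp: net_def)
          ultimately show "z \<in> (\<Union>x\<in>X n. ball x (2 * l n))"
            using dist_triangle[of x z y] by force
        qed
        have "card {x \<in> X n. U n x \<notin> F} \<le> card {x \<in> X n. ennreal t < holder_coeff \<alpha> (U n x) f}"
          using good X[of n] by (intro card_mono) (auto simp: net_def not_le[symmetric])
        also have "real \<dots> \<le> C * t powr (- p)"
          unfolding U_def
        proof (rule count[OF _ _ l(1) _ _ cover_closure \<open>t > 0\<close>])
          show "X n \<subseteq> closure E" using X[of n] closure_subset[of E] by (auto simp: net_def)
          show "l n < \<rho>0" using l(2)[of n] r by simp
        qed (use X[of n] in \<open>auto simp: net_def\<close>)
        also have "t powr (- p) = \<delta> powr (- p) * (4 * l n) powr (\<alpha> * p)"
          using \<delta> l(1)[of n] by (simp add: t_def powr_divide powr_powr powr_minus field_simps)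
        also have "(4 * l n) powr (\<alpha> * p) = (4 * r) powr (\<alpha> * p) * q ^ n"
        proof -
          have "4 * l n = 4 * r * 2 powr (- real n)"
            by (simp add: l_def powr_minus powr_realpow field_simps)
          also have "\<dots> powr (\<alpha> * p) = (4 * r) powr (\<alpha> * p) * 2 powr (- real n * (\<alpha> * p))"
            using r by (simp add: powr_mult powr_powr)
          also have "2 powr (- real n * (\<alpha> * p)) = q powr real n"
            by (simp add: q_def powr_powr mult_ac)
          also have "q powr real n = q ^ n" by (simp add: q_def powr_realpow)
          finally show ?thesis .
        qed
        finally show ?thesis by (simp add: b_def mult_ac)
      qed
    qed (use q in auto)
    then obtain k where k: "covering_number F E \<le> enat k" "real k \<le> card (X 0) + D * (b / (1 - q))"
      by blast
    have "diam_covering_number (f ` E) \<delta> \<le> enat k"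
      unfolding diam_covering_number_def
      by (rule covering_number_image_le) (use k(1) in \<open>simp add: F_def\<close>)
    moreover have "real k \<le> m + A * \<delta> powr (- p) * r powr (\<alpha> * p)"
    proof -
      have "real (card (X 0)) \<le> m" using X[of 0] by (simp add: net_def)
      moreover have "D * (b / (1 - q)) = (A - 1) * \<delta> powr (- p) * r powr (\<alpha> * p)"
        using r by (simp add: b_def A_def powr_mult)
      moreover have "\<dots> \<le> A * \<delta> powr (- p) * r powr (\<alpha> * p)"
        by (intro mult_right_mono) auto
      ultimately show ?thesis using k(2) by linarith
    qed
    ultimately show ?thesis by blast
  qed
  show ?thesis
    by (rule that[of "min \<rho>0 1" A]) (use main \<rho>0 \<open>A > 0\<close> in auto)
qed

section \<open>Minkowski dimension as growth exponent of covering numbers\<close>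

lemma eventually_at_right_0_less:
  fixes c :: real
  assumes "c > 0"
  shows "eventually (\<lambda>r. 0 < r \<and> r < c) (at_right 0)"
  using eventually_at_right_real[OF assms] by (rule eventually_mono) auto

lemma minkowski_dim_le_if_polynomial_growth:
  assumes "C > 0"
    and growth: "eventually (\<lambda>r. \<exists>k. diam_covering_number E r \<le> enat k \<and> real k \<le> C * r powr (- s)) (at_right 0)"
  shows "minkowski_dim E \<le> ereal s"
proof -
  let ?bound = "\<lambda>r. ln C / ln (1 / r) + s"
  have "eventually (\<lambda>r. log_enat (diam_covering_number E r) / ereal (ln (1 / r)) \<le> ereal (?bound r)) (at_right 0)"
    using growth eventually_at_right_0_less[OF zero_less_one]
  proof eventually_elim
    case (elim r)
    then obtain k where k: "diam_covering_number E r \<le> enat k" "real k \<le> C * r powr (- s)" by blast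
    then obtain j where j: "diam_covering_number E r = enat j" "j \<le> k"
      by (cases "diam_covering_number E r") auto
    have L: "ln (1 / r) > 0" using elim by (simp add: ln_div)
    show ?case
    proof (cases "j = 0")
      case True
      then show ?thesis using j L by (simp add: log_enat_def)
    next
      case False
      have "ln (real j) \<le> ln (C * r powr (- s))" using False j(2) k(2) by (intro ln_mono) auto
      also have "\<dots> = ln C + s * ln (1 / r)"
        using elim \<open>C > 0\<close> by (simp add: ln_mult ln_powr ln_div)
      finally have "ln (real j) / ln (1 / r) \<le> ?bound r"
        using L by (simp add: field_simps)
      then show ?thesis using False j L by (simp add: log_enat_def)
    qed
  qed
  then have "minkowski_dim E \<le> Limsup (at_right 0) (\<lambda>r. ereal (?bound r))"
    unfolding minkowski_dim_def by (rule Limsup_mono)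
  also have "\<dots> = ereal s"
  proof (rule lim_imp_Limsup)
    have "filterlim (\<lambda>r::real. - ln r) at_top (at_right 0)"
      using ln_at_0 by (simp add: filterlim_uminus_at_top)
    then have "filterlim (\<lambda>r::real. - ln r) at_infinity (at_right 0)"
      by (rule filterlim_at_top_imp_at_infinity)
    then have "((\<lambda>r::real. ln C / - ln r + s) \<longlongrightarrow> 0 + s) (at_right 0)"
      by (intro tendsto_add tendsto_divide_0[OF tendsto_const] tendsto_const)
    moreover have "eventually (\<lambda>r. ln C / - ln r + s = ?bound r) (at_right 0)"
      using eventually_at_right_0_less[OF zero_less_one]
      by (rule eventually_mono) (simp add: ln_div)
    ultimately have "(?bound \<longlongrightarrow> 0 + s) (at_right 0)"
      by (rule Lim_transform_eventually)
    then have "(?bound \<longlongrightarrow> s) (at_right 0)" by simp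
    then show "((\<lambda>r. ereal (?bound r)) \<longlongrightarrow> ereal s) (at_right 0)"
      by (rule tendsto_ereal)
  qed simp
  finally show ?thesis .
qed

lemma polynomial_growth_if_minkowski_dim_less:
  assumes "minkowski_dim E < ereal d"
  shows "eventually (\<lambda>r. \<exists>k. diam_covering_number E r = enat k \<and> real k \<le> r powr (- d)) (at_right 0)"
  using Limsup_lessD[OF assms[unfolded minkowski_dim_def]] eventually_at_right_0_less[OF zero_less_one]
proof eventually_elim
  case (elim r)
  have L: "ln (1 / r) > 0" using elim by (simp add: ln_div)
  show ?case
  proof (cases "diam_covering_number E r")
    case (enat k)
    have "real k \<le> r powr (- d)"
    proof (cases "k = 0")
      case False
      then have "ln (real k) / ln (1 / r) < d" using elim enat L by (simp add: log_enat_def)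
      then have "ln (real k) < ln (r powr (- d))"
        using L elim by (simp add: field_simps ln_powr ln_div)
      then have "real k < r powr (- d)"
        using False elim by (subst (asm) ln_less_cancel_iff) auto
      then show ?thesis by simp
    qed simp
    with enat show ?thesis by blast
  next
    case infinity
    with elim L show ?thesis by (simp add: log_enat_def)
  qed
qed

lemma minkowski_dim_nonneg:
  assumes "E \<noteq> {}"
  shows "minkowski_dim E \<ge> 0"
  unfolding minkowski_dim_def
proof (rule le_Limsup)
  show "eventually (\<lambda>r. 0 \<le> log_enat (diam_covering_number E r) / ereal (ln (1 / r))) (at_right 0)"
    using eventually_at_right_0_less[OF zero_less_one]
  proof eventually_elim
    case (elim r)
    have L: "ln (1 / r) > 0" using elim by (simp add: ln_div)
    have "\<not> diam_covering_number E r \<le> enat 0"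
    proof
      assume "diam_covering_number E r \<le> enat 0"
      then obtain C where "finite C" "E \<subseteq> \<Union>C" "card C \<le> 0"
        unfolding diam_covering_number_def covering_number_le_enat_iff by blast
      with assms show False by simp
    qed
    then have "0 \<le> log_enat (diam_covering_number E r)"
      by (cases "diam_covering_number E r") (auto simp: log_enat_def)
    with L show ?case by simp
  qed
qed simp

lemma minkowski_dim_empty: "minkowski_dim ({} :: 'a::metric_space set) = - \<infinity>"
proof -
  have "log_enat (diam_covering_number ({} :: 'a set) r) = - \<infinity>" for r
  proof -
    have "diam_covering_number ({} :: 'a set) r \<le> enat 0"
      unfolding diam_covering_number_def covering_number_le_enat_iff
      by (intro exI[of _ "{}"]) simp
    then show ?thesis by (cases "diam_covering_number ({} :: 'a set) r") (simp_all add: log_enat_def)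
  qed
  then have "eventually (\<lambda>r. log_enat (diam_covering_number ({} :: 'a set) r) / ereal (ln (1 / r)) \<le> - \<infinity>) (at_right 0)"
    by (intro eventually_mono[OF eventually_at_right_0_less[OF zero_less_one]]) (simp add: ln_div)
  then have "minkowski_dim ({} :: 'a set) \<le> - \<infinity>"
    unfolding minkowski_dim_def by (intro Limsup_bounded)
  then show ?thesis by simp
qed

section \<open>The dimension bound\<close>

text \<open>Up to constant factors, the covering number of \<open>f ` E\<close> is bounded by the sum of \<open>r powr (- d)\<close>
  and \<open>\<delta> powr (- p) * r powr (\<alpha> * p)\<close>. These agree at \<open>r = \<delta> powr \<beta>\<close> with \<open>\<beta> = p / (\<alpha> * p + d)\<close>,
  since \<open>\<beta> * d = p - \<beta> * \<alpha> * p\<close>.\<close>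

lemma minkowski_dim_image_le:
  fixes f :: "'a::metric_space \<Rightarrow> 'b::metric_space"
  assumes "doubling_space TYPE('a)" "compactly_holder p \<alpha> f" "bounded E" "compact (closure E)"
    "p > 0" "\<alpha> > 0" "d > 0" "minkowski_dim E < ereal d"
  shows "minkowski_dim (f ` E) \<le> ereal (p * d / (\<alpha> * p + d))"
proof -
  obtain \<rho> A :: real where "\<rho> > 0" "A > 0" and image:
    "\<And>\<delta> r m. \<delta> > 0 \<Longrightarrow> 0 < r \<Longrightarrow> r < \<rho> \<Longrightarrow> diam_covering_number E (r / 2) \<le> enat m \<Longrightarrow>
       \<exists>k. diam_covering_number (f ` E) \<delta> \<le> enat k \<and> real k \<le> m + A * \<delta> powr (- p) * r powr (\<alpha> * p)"
    by (rule image_covering_number_le[OF assms(1-6)]) blast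
  define e where "e = \<alpha> * p + d"
  define s where "s = p * d / e"
  define \<beta> where "\<beta> = p / e"
  have "e > 0" using assms by (simp add: e_def add_pos_pos)
  have "\<beta> > 0" using assms \<open>e > 0\<close> by (simp add: \<beta>_def)
  have \<beta>: "\<beta> * d = s" "\<beta> * (\<alpha> * p) - p = - s"
    using \<open>e > 0\<close> by (simp_all add: \<beta>_def s_def e_def field_simps)
  obtain c :: real where "c > 0" and growth: "\<And>r. 0 < r \<Longrightarrow> r < c \<Longrightarrow>
      \<exists>k. diam_covering_number E r = enat k \<and> real k \<le> r powr (- d)"
    using polynomial_growth_if_minkowski_dim_less[OF assms(8)]
    by (auto simp: eventually_at_right_field)
  define \<delta>\<^sub>0 where "\<delta>\<^sub>0 = (min \<rho> c) powr (1 / \<beta>)"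
  have "\<delta>\<^sub>0 > 0" using \<open>\<rho> > 0\<close> \<open>c > 0\<close> by (simp add: \<delta>\<^sub>0_def)
  have "eventually (\<lambda>\<delta>. \<exists>k. diam_covering_number (f ` E) \<delta> \<le> enat k \<and>
      real k \<le> (2 powr d + A) * \<delta> powr (- s)) (at_right 0)"
    using eventually_at_right_0_less[OF \<open>\<delta>\<^sub>0 > 0\<close>]
  proof eventually_elim
    case (elim \<delta>)
    define r where "r = \<delta> powr \<beta>"
    have "r < \<delta>\<^sub>0 powr \<beta>" unfolding r_def using elim \<open>\<beta> > 0\<close> by (intro powr_less_mono2) auto
    also have "\<delta>\<^sub>0 powr \<beta> = min \<rho> c" using \<open>\<beta> > 0\<close> \<open>\<rho> > 0\<close> \<open>c > 0\<close> by (simp add: \<delta>\<^sub>0_def powr_powr)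
    finally have r: "0 < r" "r < \<rho>" "r < c" using elim by (auto simp: r_def)
    obtain m where m: "diam_covering_number E (r / 2) = enat m" "real m \<le> (r / 2) powr (- d)"
      using growth[of "r / 2"] r by auto
    obtain k where k: "diam_covering_number (f ` E) \<delta> \<le> enat k"
      "real k \<le> m + A * \<delta> powr (- p) * r powr (\<alpha> * p)"
      using image[of \<delta> r m] elim r m(1) by auto
    have "(r / 2) powr (- d) = 2 powr d * \<delta> powr (- s)"
      using elim by (simp add: r_def powr_divide powr_powr powr_minus \<beta>(1) field_simps)
    moreover have "\<delta> powr (- p) * r powr (\<alpha> * p) = \<delta> powr (- s)"
      by (simp add: r_def powr_powr \<beta>(2) flip: powr_add)
    ultimately have "real k \<le> (2 powr d + A) * \<delta> powr (- s)"
      using k(2) m(2) by (simp add: algebra_simps)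
    with k(1) show ?case by blast
  qed
  moreover have "2 powr d + A > 0" using \<open>A > 0\<close> by (simp add: add_pos_pos)
  ultimately show ?thesis
    using minkowski_dim_le_if_polynomial_growth unfolding s_def e_def by blast
qed

theorem theorem1p1:
  fixes f :: "'a::metric_space \<Rightarrow> 'b::metric_space"
    and p \<alpha> :: real and E :: "'a set" and d\<^sub>E :: ereal
  assumes "proper_space TYPE('a)" and "doubling_space TYPE('a)"
    and "p > 1" and "0 < \<alpha>" and "\<alpha> < 1"
    and "compactly_holder p \<alpha> f"
    and "bounded E" and "minkowski_dim E = d\<^sub>E"
  shows "minkowski_dim (f ` E) \<le> ereal p * d\<^sub>E / (ereal (\<alpha> * p) + d\<^sub>E)"
proof (cases "E = {}")
  case True
  \<comment> \<open>Both numerator and denominator of the bound are \<open>- \<infinity>\<close> here, so the bound is \<open>0\<close>.\<close>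
  with assms(8) have "d\<^sub>E = - \<infinity>" by (simp add: minkowski_dim_empty)
  with True show ?thesis by (simp add: minkowski_dim_empty)
next
  case False
  have "compact (closure E)"
    using assms(1) bounded_closure[OF assms(7)] closed_closure unfolding proper_space_def by blast
  \<comment> \<open>The dimension must first be shown to be finite: in \<open>ereal\<close> the quotient \<open>\<infinity> / \<infinity>\<close> is \<open>0\<close>.\<close>
  obtain C s :: real where "C > 0" "\<And>r. 0 < r \<Longrightarrow> r < 1 \<Longrightarrow>
    \<exists>k. diam_covering_number E r \<le> enat k \<and> real k \<le> C * r powr (- s)"
    by (rule bounded_covering_number_polynomial[OF assms(2,7)]) blast
  then have "minkowski_dim E \<le> ereal s"
    by (intro minkowski_dim_le_if_polynomial_growth[of C]
          eventually_mono[OF eventually_at_right_0_less[OF zero_less_one]]) auto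
  moreover have "minkowski_dim E \<ge> 0" using False by (rule minkowski_dim_nonneg)
  ultimately obtain D where D: "minkowski_dim E = ereal D" "D \<ge> 0"
    by (cases "minkowski_dim E") auto
  have "\<alpha> * p > 0" using assms by simp
  \<comment> \<open>Real exponents \<open>d > D\<close> all satisfy the bound, which is continuous in \<open>d\<close>; let \<open>d\<close> decrease
    to \<open>D\<close>.\<close>
  have "minkowski_dim (f ` E) \<le> ereal (p * D / (\<alpha> * p + D))"
  proof (rule tendsto_lowerbound)
    have "((\<lambda>d. p * d / (\<alpha> * p + d)) \<longlongrightarrow> p * D / (\<alpha> * p + D)) (at_right D)"
      using \<open>\<alpha> * p > 0\<close> D(2) by (intro tendsto_intros) auto
    then show "((\<lambda>d. ereal (p * d / (\<alpha> * p + d))) \<longlongrightarrow> ereal (p * D / (\<alpha> * p + D))) (at_right D)"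
      by (rule tendsto_ereal)
    show "eventually (\<lambda>d. minkowski_dim (f ` E) \<le> ereal (p * d / (\<alpha> * p + d))) (at_right D)"
      using eventually_at_right_less[of D]
    proof eventually_elim
      case (elim d)
      then show ?case
        using assms D \<open>compact (closure E)\<close> by (intro minkowski_dim_image_le) auto
    qed
  qed simp
  moreover have "d\<^sub>E = ereal D" using assms(8) D(1) by simp
  moreover have "\<alpha> * p + D \<noteq> 0" using \<open>\<alpha> * p > 0\<close> D(2) by simp
  ultimately show ?thesis by simp
qed

end
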